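(* Let $p\geq 1$, $q\geq 0$ be integers. The isometric embedding $\iota_{p,q}\colon\mathcal H^{p,q}\to\mathbb H^{p,q}$ given by $$\iota_{p,q}(x,y,z)=\left[\frac{x}{z}:\frac{1-h(x,y)-z^2}{2z}:\frac{y}{z}:\frac{1+h(x,y)+z^2}{2z}\right]$$ extends to an embedding $\partial\mathcal H^{p,q}\hookrightarrow\partial_\infty\mathbb H^{p,q}$.
   Context: $\mathbb R^{p,q+1}$ is $\mathbb R^{p+q+1}$ with the bilinear form $\langle X,Y\rangle=X_1Y_1+\dots+X_pY_p-X_{p+1}Y_{p+1}-\dots-X_{p+q+1}Y_{p+q+1}$. Pseudo-hyperbolic space is $\mathbb H^{p,q}=\{X\in\mathbb R^{p,q+1}:\langle X,X\rangle=-1\}/\{\pm\mathrm{Id}\}$ with the induced pseudo-Riemannian metric, regarded as a subset of $\mathbb R\mathrm P^{p+q}$. Its boundary at infinity is $\partial_\infty\mathbb H^{p,q}=\mathrm P\{X\in\mathbb R^{p,q+1}:\langle X,X\rangle=0\}\subset\mathbb R\mathrm P^{p+q}$ (projective classes of nonzero null vectors). The half-space model is $\mathcal H^{p,q}=\{(x,y,z)\in\mathbb R^{p-1}\oplus\mathbb R^q\oplus\mathbb R : z>0\}$ with the metric $g_{p,q}=\frac{dx_1^2+\dots+dx_{p-1}^2-dy_1^2-\dots-dy_q^2+dz^2}{z^2}$, and $\partial\mathcal H^{p,q}=\{z=0\}$ is its boundary in $\mathbb R^{p+q}$. Here $h(x,y)=x_1^2+\dots+x_{p-1}^2-y_1^2-\dots-y_q^2$,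 and in the formula for $\iota_{p,q}$ the entries are, in order, coordinates $1,\dots,p-1$; coordinate $p$; coordinates $p+1,\dots,p+q$; coordinate $p+q+1$. The extension is meant as a map from $\mathcal H^{p,q}\cup\partial\mathcal H^{p,q}$ to $\mathbb H^{p,q}\cup\partial_\infty\mathbb H^{p,q}\subset\mathbb R\mathrm P^{p+q}$. *)

theory Defs
  imports "HOL-Analysis.Analysis"
begin

section \<open>Numbered coordinates\<close>

text \<open>
  The dimensions \<open>p + q\<close> and \<open>p + q + 1\<close> are carried by finite, linearly ordered index types; the
  linear order gives the coordinates their numbers \<open>1, 2, \<dots>\<close>. Every positive dimension occurs,
  for instance with the numeral types. A separate type for each of the summands of
  \<open>\<real>\<^sup>p\<^sup>-\<^sup>1 \<oplus> \<real>\<^sup>q \<oplus> \<real>\<close> would exclude the cases \<open>p = 1\<close> and \<open>q = 0\<close>.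
\<close>

definition pos :: "'n::{finite,linorder} \<Rightarrow> nat" where
  "pos j = card {..j}"

definition coord :: "real^'n::{finite,linorder} \<Rightarrow> nat \<Rightarrow> real" where
  "coord X i = X $ (inv pos i)"

definition vec_of :: "(nat \<Rightarrow> real) \<Rightarrow> real^'n::{finite,linorder}" where
  "vec_of f = (\<chi> j. f (pos j))"

lemma inj_pos: "inj (pos :: 'n::{finite,linorder} \<Rightarrow> nat)"
proof (rule linorder_injI)
  fix x y :: 'n
  assume "x < y"
  then have "{..x} \<subset> {..y}" by auto
  then have "card {..x} < card {..y}" by (intro psubset_card_mono) auto
  then show "pos x \<noteq> pos y" by (simp add: pos_def)
qed

lemma bij_betw_pos: "bij_betw (pos :: 'n::{finite,linorder} \<Rightarrow> nat) UNIV {1..CARD('n)}"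
proof -
  have sub: "range (pos :: 'n \<Rightarrow> nat) \<subseteq> {1..CARD('n)}"
    by (auto simp: pos_def Suc_le_eq card_gt_0_iff intro!: card_mono)
  moreover have "card (range (pos :: 'n \<Rightarrow> nat)) = card {1..CARD('n)}"
    by (simp add: card_image inj_pos)
  ultimately have "range (pos :: 'n \<Rightarrow> nat) = {1..CARD('n)}"
    by (intro card_subset_eq) auto
  then show ?thesis by (simp add: bij_betw_def inj_pos)
qed

lemma coord_vec_of:
  assumes "1 \<le> i" "i \<le> CARD('n::{finite,linorder})"
  shows "coord (vec_of f :: real^'n::_) i = f i"
proof -
  have "i \<in> range (pos :: 'n \<Rightarrow> nat)"
    using assms bij_betw_imp_surj_on[OF bij_betw_pos[where 'n = 'n]] by auto
  then show ?thesis by (simp add: coord_def vec_of_def f_inv_into_f)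
qed

lemma coord_pos: "coord X (pos j) = X $ j"
  by (simp add: coord_def inj_pos)


section \<open>Real projective space\<close>

text \<open>The projective class of a nonzero vector is the line that it spans.\<close>

definition proj_class :: "'a::real_vector \<Rightarrow> 'a set" where
  "proj_class X = span {X}"

definition RP :: "'a::real_vector set set" where
  "RP = proj_class ` (- {0})"

definition RP_topology :: "'a::real_normed_vector set topology" where
  "RP_topology = topology (\<lambda>U. U \<subseteq> RP \<and> open {X. X \<noteq> 0 \<and> proj_class X \<in> U})"

lemma openin_RP_topology:
  "openin RP_topology U \<longleftrightarrow> U \<subseteq> RP \<and> open {X::'a::real_normed_vector. X \<noteq> 0 \<and> proj_class X \<in> U}"
proof -
  let ?P = "\<lambda>U. U \<subseteq> RP \<and> open {X::'a. X \<noteq> 0 \<and> proj_class X \<in> U}"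
  have "istopology ?P"
    unfolding istopology_def
  proof safe
    fix S T :: "'a set set"
    assume "open {X. X \<noteq> 0 \<and> proj_class X \<in> S}" "open {X. X \<noteq> 0 \<and> proj_class X \<in> T}"
    then have "open ({X. X \<noteq> 0 \<and> proj_class X \<in> S} \<inter> {X. X \<noteq> 0 \<and> proj_class X \<in> T})"
      by (rule open_Int)
    also have "{X. X \<noteq> 0 \<and> proj_class X \<in> S} \<inter> {X. X \<noteq> 0 \<and> proj_class X \<in> T}
        = {X. X \<noteq> 0 \<and> proj_class X \<in> S \<inter> T}" by auto
    finally show "open {X. X \<noteq> 0 \<and> proj_class X \<in> S \<inter> T}" .
  next
    fix K :: "'a set set set"
    assume K: "\<forall>U\<in>K. ?P U"
    have "open (\<Union>U\<in>K. {X. X \<noteq> 0 \<and> proj_class X \<in> U})" using K by blast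
    also have "(\<Union>U\<in>K. {X. X \<noteq> 0 \<and> proj_class X \<in> U}) = {X. X \<noteq> 0 \<and> proj_class X \<in> \<Union>K}"
      by auto
    finally show "open {X. X \<noteq> 0 \<and> proj_class X \<in> \<Union>K}" .
  qed auto
  then show ?thesis by (simp add: RP_topology_def topology_inverse')
qed

lemma topspace_RP_topology: "topspace RP_topology = (RP :: 'a::real_normed_vector set set)"
proof -
  have "{X::'a. X \<noteq> 0 \<and> proj_class X \<in> RP} = - {0}" by (auto simp: RP_def)
  then have "openin RP_topology (RP :: 'a set set)"
    by (simp add: openin_RP_topology open_Compl)
  then show ?thesis
    by (metis openin_RP_topology openin_subset openin_topspace subset_antisym)
qed


section \<open>Smooth embeddings into real projective space\<close>

text \<open>\<open>Ck_on k f S\<close> is meant for open sets \<open>S\<close>: the function \<open>f\<close> is of class \<open>C\<^sup>k\<close> on \<open>S\<close>.\<close>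

primrec Ck_on ::
  "nat \<Rightarrow> ('a::real_normed_vector \<Rightarrow> 'b::real_normed_vector) \<Rightarrow> 'a set \<Rightarrow> bool" where
  "Ck_on 0 f S \<longleftrightarrow> continuous_on S f"
| "Ck_on (Suc k) f S \<longleftrightarrow>
     (\<forall>u\<in>S. f differentiable (at u)) \<and> (\<forall>v. Ck_on k (\<lambda>u. frechet_derivative f (at u) v) S)"

definition smooth_map_on ::
  "('a::real_normed_vector \<Rightarrow> 'b::real_normed_vector) \<Rightarrow> 'a set \<Rightarrow> bool" where
  "smooth_map_on f S \<longleftrightarrow> (\<forall>k. Ck_on k f S)"

text \<open>
  Here \<open>S\<close> is a relatively open subset of an affine subspace with direction space \<open>T\<close>, so that \<open>T\<close>
  is the tangent space of \<open>S\<close> at each of its points. Locally, \<open>f\<close> is represented in homogeneous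
  coordinates by a function \<open>F\<close> that is smooth on an open subset \<open>V\<close> of the ambient space. The tangent
  space of the projective space at the class of \<open>F u\<close> is the quotient by the line \<open>span {F u}\<close> (up to
  a scaling), hence the form of the condition that the differential of \<open>f\<close> is injective on \<open>T\<close>.
\<close>

definition smooth_immersion_RP ::
  "'a::real_normed_vector set \<Rightarrow> 'a set \<Rightarrow> ('a \<Rightarrow> 'b::real_normed_vector set) \<Rightarrow> bool" where
  "smooth_immersion_RP S T f \<longleftrightarrow>
     (\<forall>u\<in>S. \<exists>V F. open V \<and> u \<in> V \<and> smooth_map_on F V \<and>
        (\<forall>w\<in>V \<inter> S. F w \<noteq> 0 \<and> f w = proj_class (F w)) \<and>
        (\<forall>v\<in>T. frechet_derivative F (at u) v \<in> span {F u} \<longrightarrow> v = 0))"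

text \<open>A smooth embedding into a submanifold \<open>N\<close> of the projective space.\<close>

definition smooth_embedding_RP ::
  "'a::real_normed_vector set \<Rightarrow> 'a set \<Rightarrow> 'b::real_normed_vector set set \<Rightarrow> ('a \<Rightarrow> 'b set) \<Rightarrow> bool" where
  "smooth_embedding_RP S T N f \<longleftrightarrow>
     embedding_map (top_of_set S) (subtopology RP_topology N) f \<and> smooth_immersion_RP S T f"


section \<open>Pseudo-hyperbolic space and its boundary at infinity\<close>

definition pform :: "nat \<Rightarrow> nat \<Rightarrow> real^'n::{finite,linorder} \<Rightarrow> real^'n::_ \<Rightarrow> real" where
  "pform p q X Y =
     (\<Sum>i=1..p. coord X i * coord Y i) - (\<Sum>i=p+1..p+q+1. coord X i * coord Y i)"

text \<open>Two vectors with \<open>pform p q X X = -1\<close> span the same line iff they agree up to sign.\<close>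

definition pseudo_hyperbolic :: "nat \<Rightarrow> nat \<Rightarrow> (real^'n::{finite,linorder}) set set" where
  "pseudo_hyperbolic p q = proj_class ` {X. pform p q X X = -1}"

definition boundary_at_infinity :: "nat \<Rightarrow> nat \<Rightarrow> (real^'n::{finite,linorder}) set set" where
  "boundary_at_infinity p q = proj_class ` {X. X \<noteq> 0 \<and> pform p q X X = 0}"

text \<open>
  The metric of pseudo-hyperbolic space is the one for which the two-to-one projection from
  \<open>{X. pform p q X X = -1}\<close>, with the restriction of the form to its tangent spaces, is a local
  isometry. So the pullback of this metric by \<open>f\<close> is computed with local lifts \<open>F\<close> of \<open>f\<close>.
  The set \<open>S\<close> is open here, and \<open>g u\<close> is a bilinear form on the tangent space at \<open>u\<close>.
\<close>

definition isometric_embedding_PH ::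
  "nat \<Rightarrow> nat \<Rightarrow> 'a::real_normed_vector set \<Rightarrow> ('a \<Rightarrow> 'a \<Rightarrow> 'a \<Rightarrow> real)
     \<Rightarrow> ('a \<Rightarrow> (real^'n::{finite,linorder}) set) \<Rightarrow> bool" where
  "isometric_embedding_PH p q S g f \<longleftrightarrow>
     smooth_embedding_RP S UNIV (pseudo_hyperbolic p q) f \<and>
     (\<forall>u\<in>S. \<exists>V F. open V \<and> u \<in> V \<and> V \<subseteq> S \<and> smooth_map_on F V \<and>
        (\<forall>w\<in>V. pform p q (F w) (F w) = -1 \<and> f w = proj_class (F w)) \<and>
        (\<forall>v w. pform p q (frechet_derivative F (at u) v) (frechet_derivative F (at u) w) = g u v w))"


section \<open>The half-space model\<close>

text \<open>
  A point \<open>(x, y, z)\<close> of \<open>\<real>\<^sup>p\<^sup>-\<^sup>1 \<oplus> \<real>\<^sup>q \<oplus> \<real>\<close> has \<open>x\<close> as its coordinates \<open>1, \<dots>, p - 1\<close>,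
  \<open>y\<close> as its coordinates \<open>p, \<dots>, p + q - 1\<close>, and \<open>z\<close> as its coordinate \<open>p + q\<close>.
\<close>

definition half_space :: "nat \<Rightarrow> nat \<Rightarrow> (real^'m::{finite,linorder}) set" where
  "half_space p q = {u. coord u (p + q) > 0}"

text \<open>This is a linear subspace, so it is also its own direction space.\<close>

definition half_space_boundary :: "nat \<Rightarrow> nat \<Rightarrow> (real^'m::{finite,linorder}) set" where
  "half_space_boundary p q = {u. coord u (p + q) = 0}"

text \<open>The polarization of \<open>h\<close>; it does not involve the coordinate \<open>z\<close>.\<close>

definition hform :: "nat \<Rightarrow> nat \<Rightarrow> real^'m::{finite,linorder} \<Rightarrow> real^'m::_ \<Rightarrow> real" where
  "hform p q v w =
     (\<Sum>i=1..<p. coord v i * coord w i) - (\<Sum>i=p..<p+q. coord v i * coord w i)"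

definition half_space_metric ::
  "nat \<Rightarrow> nat \<Rightarrow> real^'m::{finite,linorder} \<Rightarrow> real^'m::_ \<Rightarrow> real^'m::_ \<Rightarrow> real" where
  "half_space_metric p q u v w =
     (hform p q v w + coord v (p + q) * coord w (p + q)) / (coord u (p + q))\<^sup>2"

text \<open>
  The entry \<open>p + j\<close> of the image is \<open>y\<^sub>j / z\<close>, and \<open>y\<^sub>j\<close> is the coordinate \<open>p + j - 1\<close> of \<open>u\<close>.
\<close>

definition iota :: "nat \<Rightarrow> nat \<Rightarrow> real^'m::{finite,linorder} \<Rightarrow> (real^'n::{finite,linorder}) set" where
  "iota p q u =
     (let z = coord u (p + q); h = hform p q u u in
      proj_class (vec_of (\<lambda>i.
        if i < p then coord u i / z
        else if i = p then (1 - h - z\<^sup>2) / (2 * z)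
        else if i \<le> p + q then coord u (i - 1) / z
        else (1 + h + z\<^sup>2) / (2 * z))))"

end

theory Submission
  imports Defs
begin

text \<open>
  Clear the denominator \<open>z\<close> in the homogeneous coordinates of \<open>iota\<close>. This gives the vector
  \<open>lift u\<close> with entries \<open>x\<close>, \<open>(1 - k) / 2\<close>, \<open>y\<close>, \<open>(1 + k) / 2\<close>, where \<open>k = h(x, y) + z\<^sup>2\<close>. It is
  polynomial in \<open>u = (x, y, z)\<close>, so it makes sense for all \<open>z\<close>, and \<open>z = 0\<close> in particular. It never
  vanishes, since its entries \<open>p\<close> and \<open>p + q + 1\<close> add up to \<open>1\<close>, and its square with respect to the
  form is \<open>h - k = -z\<^sup>2\<close> (\<open>pform_lift\<close>). So the class of \<open>lift u\<close> equals \<open>iota u\<close> for \<open>z > 0\<close> and lies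
  in the boundary at infinity for \<open>z = 0\<close>. This is the extension.

  Embedding. Let \<open>height\<close> be the sum of the entries \<open>p\<close> and \<open>p + q + 1\<close>. On the affine chart
  \<open>height \<noteq> 0\<close> a point with \<open>z \<ge> 0\<close> is recovered from the class of its lift \<open>X\<close>: the quotients of
  entries of \<open>X\<close> by \<open>height X\<close> are \<open>x\<close> and \<open>y\<close>, and \<open>z\<close> is the square root of \<open>-\<langle>X, X\<rangle> / (height X)\<^sup>2\<close>.
  These formulas define a map \<open>chart\<close> that is continuous and homogeneous of degree \<open>0\<close>, which makes
  the extension a homeomorphism onto its image (\<open>embedding_map_proj_class\<close>).

  Immersion. Since \<open>height\<close> is constantly \<open>1\<close> along the lift, a derivative of the lift has height \<open>0\<close>.
  If it is also a multiple of the lift, then it vanishes, and its entries then force the direction to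
  vanish, unless \<open>z = 0\<close> and the direction is transversal to the boundary. Both the interior and the
  boundary are covered by the single lemma \<open>lift_smooth_embedding\<close>.

  Isometry. The vector \<open>lift u / z\<close> has square \<open>-1\<close>, and the pullback of the form by it follows from
  the inner products of the lift and its derivatives.
\<close>

section \<open>Calculus of smooth maps\<close>

lemma Ck_on_cong:
  assumes "open S" "\<And>u. u \<in> S \<Longrightarrow> f u = g u" "Ck_on k f S"
  shows "Ck_on k g S"
  using assms(2,3)
proof (induction k arbitrary: f g)
  case 0
  then show ?case using continuous_on_cong[of S S f g] by simp
next
  case (Suc k)
  have diff: "f differentiable (at u)" if "u \<in> S" for u using Suc.prems(2) that by simp
  have eq: "frechet_derivative f (at u) = frechet_derivative g (at u)" if "u \<in> S" for u
    using frechet_derivative_transform_within_open[OF diff[OF that] assms(1) that] Suc.prems(1)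
    by blast
  have "g differentiable (at u)" if "u \<in> S" for u
    using diff[OF that] has_derivative_transform_within_open[OF _ assms(1) that] Suc.prems(1)
    unfolding differentiable_def by blast
  moreover have "Ck_on k (\<lambda>u. frechet_derivative g (at u) v) S" for v
    by (rule Suc.IH[of "\<lambda>u. frechet_derivative f (at u) v"]) (use eq Suc.prems(2) in auto)
  ultimately show ?case by simp
qed

text \<open>
  Any formula for the derivative on \<open>S\<close> can replace the choice made by \<open>frechet_derivative\<close>,
  because derivatives at interior points are unique.
\<close>

lemma Ck_on_SucI:
  assumes "open S" "\<And>u. u \<in> S \<Longrightarrow> (f has_derivative f' u) (at u)"
    "\<And>v. Ck_on k (\<lambda>u. f' u v) S"
  shows "Ck_on (Suc k) f S"
proof -
  have "f' u v = frechet_derivative f (at u) v" if "u \<in> S" for u v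
    using frechet_derivative_at[OF assms(2)[OF that]] by simp
  then have "Ck_on k (\<lambda>u. frechet_derivative f (at u) v) S" for v
    by (intro Ck_on_cong[OF assms(1) _ assms(3)]) auto
  then show ?thesis using assms(2) by (auto simp: differentiable_def)
qed

lemma Ck_on_SucD: "Ck_on (Suc k) f S \<Longrightarrow> Ck_on k f S"
proof (induction k arbitrary: f)
  case 0
  then show ?case
    by (auto intro!: continuous_at_imp_continuous_on differentiable_imp_continuous_within)
next
  case (Suc k)
  from Suc.prems have "\<forall>u\<in>S. f differentiable (at u)"
    "Ck_on (Suc k) (\<lambda>u. frechet_derivative f (at u) v) S" for v by auto
  then show ?case using Suc.IH by simp
qed

lemma Ck_on_const: "open S \<Longrightarrow> Ck_on k (\<lambda>_. c) S"
  by (induction k arbitrary: c) (auto intro!: Ck_on_SucI continuous_on_const derivative_eq_intros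
      simp del: Ck_on.simps(2))

lemma Ck_on_linear:
  assumes "open S" "bounded_linear f"
  shows "Ck_on k f S"
proof (cases k)
  case 0
  then show ?thesis using assms by (simp add: linear_continuous_on)
next
  case (Suc l)
  then show ?thesis
    using Ck_on_SucI[OF assms(1) bounded_linear_imp_has_derivative[OF assms(2)]
        Ck_on_const[OF assms(1)]] by simp
qed

lemma Ck_on_add:
  assumes "open S" "Ck_on k f S" "Ck_on k g S"
  shows "Ck_on k (\<lambda>u. f u + g u) S"
  using assms(2,3)
proof (induction k arbitrary: f g)
  case 0
  then show ?case by (simp add: continuous_on_add)
next
  case (Suc k)
  show ?case
  proof (rule Ck_on_SucI[OF assms(1)])
    show "((\<lambda>u. f u + g u) has_derivative
        (\<lambda>v. frechet_derivative f (at u) v + frechet_derivative g (at u) v)) (at u)"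
      if "u \<in> S" for u
      using Suc.prems that by (intro has_derivative_add) (auto simp: frechet_derivative_works)
    show "Ck_on k (\<lambda>u. frechet_derivative f (at u) v + frechet_derivative g (at u) v) S" for v
      using Suc by simp
  qed
qed

text \<open>
  One product rule serves for multiplication by scalars and for the quadratic form
  \<open>u \<mapsto> B u u\<close> alike.
\<close>

lemma Ck_on_bilinear:
  assumes "bounded_bilinear B" "open S" "Ck_on k f S" "Ck_on k g S"
  shows "Ck_on k (\<lambda>u. B (f u) (g u)) S"
  using assms(3,4)
proof (induction k arbitrary: f g)
  case 0
  then show ?case by (simp add: bounded_bilinear.continuous_on[OF assms(1)])
next
  case (Suc k)
  show ?case
  proof (rule Ck_on_SucI[OF assms(2)])
    show "((\<lambda>u. B (f u) (g u)) has_derivative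
        (\<lambda>v. B (f u) (frechet_derivative g (at u) v) + B (frechet_derivative f (at u) v) (g u)))
        (at u)"
      if "u \<in> S" for u
      using Suc.prems that
      by (intro bounded_bilinear.FDERIV[OF assms(1)]) (auto simp: frechet_derivative_works)
    show "Ck_on k (\<lambda>u. B (f u) (frechet_derivative g (at u) v)
        + B (frechet_derivative f (at u) v) (g u)) S" for v
      using Suc.IH Ck_on_SucD[OF Suc.prems(1)] Ck_on_SucD[OF Suc.prems(2)] Suc.prems
      by (intro Ck_on_add[OF assms(2)]) auto
  qed
qed

text \<open>
  The derivative \<open>-f' / f\<^sup>2\<close> of \<open>1 / f\<close> contains \<open>1 / f\<close> without derivatives, so
  induction on the order of differentiability applies.
\<close>

lemma Ck_on_inverse:
  fixes f :: "'a::real_normed_vector \<Rightarrow> real"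
  assumes "open S" "\<And>u. u \<in> S \<Longrightarrow> f u \<noteq> 0" "Ck_on k f S"
  shows "Ck_on k (\<lambda>u. inverse (f u)) S"
  using assms(3)
proof (induction k)
  case 0
  then show ?case using assms(2) by (simp add: continuous_on_inverse)
next
  case (Suc k)
  note mult = Ck_on_bilinear[OF bounded_bilinear_mult assms(1)]
  show ?case
  proof (rule Ck_on_SucI[OF assms(1)])
    show "((\<lambda>u. inverse (f u)) has_derivative
        (\<lambda>v. - 1 * (inverse (f u) * frechet_derivative f (at u) v * inverse (f u)))) (at u)"
      if "u \<in> S" for u
      using Suc.prems that assms(2)
      by (auto intro!: derivative_eq_intros simp: frechet_derivative_works)
    show "Ck_on k (\<lambda>u. - 1 * (inverse (f u) * frechet_derivative f (at u) v * inverse (f u))) S"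
      for v
      using Suc.IH[OF Ck_on_SucD[OF Suc.prems]] Suc.prems Ck_on_const[OF assms(1)]
      by (intro mult) auto
  qed
qed


section \<open>Topology of the projective space\<close>

lemma proj_class_scaleR: "c \<noteq> 0 \<Longrightarrow> proj_class (c *\<^sub>R X) = proj_class X"
  unfolding proj_class_def using span_image_scale[of "{X}" "\<lambda>_. c"] by simp

lemma proj_class_eqD:
  assumes "proj_class X = proj_class Y" "X \<noteq> 0"
  obtains c where "c \<noteq> 0" "X = c *\<^sub>R Y"
proof -
  have "X \<in> span {Y}" using assms(1) span_base[of X "{X}"] by (auto simp: proj_class_def)
  then obtain c where "X = c *\<^sub>R Y" by (auto simp: span_singleton)
  with assms(2) that show ?thesis by (cases "c = 0") auto
qed

lemma continuous_map_proj_class: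
  fixes F :: "'a::real_normed_vector \<Rightarrow> 'b::real_normed_vector"
  assumes "continuous_on S F" "\<And>u. u \<in> S \<Longrightarrow> F u \<noteq> 0"
    and "\<And>u. u \<in> S \<Longrightarrow> proj_class (F u) \<in> N"
  shows "continuous_map (top_of_set S) (subtopology RP_topology N) (\<lambda>u. proj_class (F u))"
proof -
  have "continuous_map (top_of_set S) RP_topology (\<lambda>u. proj_class (F u))"
    unfolding continuous_map
  proof (intro conjI allI impI)
    show "(\<lambda>u. proj_class (F u)) ` topspace (top_of_set S) \<subseteq> topspace RP_topology"
      using assms(2) by (auto simp: topspace_RP_topology RP_def)
    fix U :: "'b set set"
    assume "openin RP_topology U"
    then have "open {X. X \<noteq> 0 \<and> proj_class X \<in> U}" by (simp add: openin_RP_topology)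
    then have "openin (top_of_set S) (S \<inter> F -` {X. X \<noteq> 0 \<and> proj_class X \<in> U})"
      by (rule continuous_openin_preimage_gen[OF assms(1)])
    moreover have "S \<inter> F -` {X. X \<noteq> 0 \<and> proj_class X \<in> U}
        = {u \<in> topspace (top_of_set S). proj_class (F u) \<in> U}"
      using assms(2) by auto
    ultimately show "openin (top_of_set S) {u \<in> topspace (top_of_set S). proj_class (F u) \<in> U}"
      by simp
  qed
  then show ?thesis using assms(3) by (auto simp: continuous_map_in_subtopology)
qed

text \<open>
  A left inverse \<open>G\<close> of \<open>F\<close> that is homogeneous of degree \<open>0\<close> on an open cone descends to the
  projective space. The image of a relatively open set \<open>S \<inter> W\<close> is the trace on the image of \<open>S\<close> of
  the classes of \<open>G -` W\<close>. These classes form an open set because \<open>G\<close> is defined on an open cone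
  and not only on the image.
\<close>

lemma embedding_map_proj_class:
  fixes F :: "'a::real_normed_vector \<Rightarrow> 'b::real_normed_vector"
  assumes cont: "continuous_on S F" and N: "\<And>u. u \<in> S \<Longrightarrow> proj_class (F u) \<in> N"
    and D: "open D" "0 \<notin> D" "\<And>u. u \<in> S \<Longrightarrow> F u \<in> D"
    and D_scale: "\<And>c X. c \<noteq> 0 \<Longrightarrow> X \<in> D \<Longrightarrow> c *\<^sub>R X \<in> D"
    and G: "continuous_on D G" "\<And>c X. c \<noteq> 0 \<Longrightarrow> X \<in> D \<Longrightarrow> G (c *\<^sub>R X) = G X"
    and GF: "\<And>u. u \<in> S \<Longrightarrow> G (F u) = u"
  shows "embedding_map (top_of_set S) (subtopology RP_topology N) (\<lambda>u. proj_class (F u))"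
    (is "embedding_map _ _ ?f")
proof -
  have nz: "F u \<noteq> 0" if "u \<in> S" for u using D(2,3) that by metis
  have contf: "continuous_map (top_of_set S) (subtopology RP_topology N) ?f"
    by (rule continuous_map_proj_class) (use cont nz N in auto)
  \<comment> \<open>Membership in \<open>D\<close> and the value of \<open>G\<close> depend on the class of a vector only.\<close>
  have transfer: "X \<in> D \<and> G X = G Y" if "Y \<in> D" "X \<noteq> 0" "proj_class X = proj_class Y" for X Y
    using proj_class_eqD[OF that(3,2)] D_scale G(2) that(1) by metis
  have inj: "inj_on ?f S"
  proof (rule inj_onI)
    fix u w assume "u \<in> S" "w \<in> S" "?f u = ?f w"
    then have "G (F u) = G (F w)" using transfer[OF D(3) nz] by blast
    then show "u = w" using GF \<open>u \<in> S\<close> \<open>w \<in> S\<close> by simp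
  qed
  have open_f: "open_map (top_of_set S) (subtopology (subtopology RP_topology N) (?f ` S)) ?f"
    unfolding open_map_def
  proof (intro allI impI)
    fix U
    assume "openin (top_of_set S) U"
    then obtain W where W: "open W" "U = S \<inter> W" by (auto simp: openin_open)
    let ?Q = "proj_class ` (D \<inter> G -` W)"
    have "{X. X \<noteq> 0 \<and> proj_class X \<in> ?Q} = D \<inter> G -` W"
      using transfer D(2) by fastforce
    moreover have "open (D \<inter> G -` W)"
      using continuous_open_preimage[OF G(1) D(1) W(1)] .
    ultimately have Q: "openin RP_topology ?Q"
      using D(2) by (auto simp: openin_RP_topology RP_def)
    have "?f ` U = ?Q \<inter> (N \<inter> ?f ` S)"
    proof (intro equalityI subsetI)
      fix l assume "l \<in> ?f ` U"
      then show "l \<in> ?Q \<inter> (N \<inter> ?f ` S)" using W(2) D(3) GF N by auto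
    next
      fix l assume "l \<in> ?Q \<inter> (N \<inter> ?f ` S)"
      then obtain u Y where u: "u \<in> S" "l = ?f u" and Y: "Y \<in> D" "G Y \<in> W" "l = proj_class Y"
        by auto
      have "G (F u) = G Y" using transfer[OF Y(1) nz[OF u(1)]] u(2) Y(3) by simp
      then show "l \<in> ?f ` U" using u Y(2) GF W(2) by auto
    qed
    then show "openin (subtopology (subtopology RP_topology N) (?f ` S)) (?f ` U)"
      using Q by (auto simp: subtopology_subtopology openin_subtopology)
  qed
  have contf': "continuous_map (top_of_set S) (subtopology (subtopology RP_topology N) (?f ` S)) ?f"
    using contf by (simp add: continuous_map_in_subtopology)
  have "?f ` topspace (top_of_set S) = topspace (subtopology (subtopology RP_topology N) (?f ` S))"
    using N nz by (auto simp: topspace_RP_topology RP_def)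
  then show ?thesis
    unfolding embedding_map_def
    using bijective_open_imp_homeomorphic_map[OF contf' open_f] inj by simp
qed

lemma smooth_immersion_RP_cong:
  assumes "\<And>u. u \<in> S \<Longrightarrow> f u = g u"
  shows "smooth_immersion_RP S T f \<longleftrightarrow> smooth_immersion_RP S T g"
proof -
  have "(\<forall>w\<in>V \<inter> S. F w \<noteq> 0 \<and> f w = proj_class (F w))
      \<longleftrightarrow> (\<forall>w\<in>V \<inter> S. F w \<noteq> 0 \<and> g w = proj_class (F w))" for V F
    using assms by auto
  then show ?thesis by (simp only: smooth_immersion_RP_def)
qed


section \<open>Coordinates and forms\<close>

lemma coord_add: "coord (X + Y) i = coord X i + coord Y i"
  by (simp add: coord_def)

lemma coord_scaleR: "coord (c *\<^sub>R X) i = c * coord X i"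
  by (simp add: coord_def)

lemma bounded_linear_coord: "bounded_linear (\<lambda>X. coord X i)"
  unfolding coord_def by (rule bounded_linear_vec_nth)

lemma pos_bounds: "1 \<le> pos (j :: 'n::{finite,linorder})" "pos j \<le> CARD('n)"
  using bij_betwE[OF bij_betw_pos] by auto

lemma vec_of_eqI:
  fixes X :: "real^'n::{finite,linorder}"
  assumes "\<And>i. 1 \<le> i \<Longrightarrow> i \<le> CARD('n) \<Longrightarrow> f i = coord X i"
  shows "vec_of f = X"
  using assms pos_bounds[where 'n = 'n] by (simp add: vec_of_def vec_eq_iff coord_pos)

lemma coord_eqI:
  fixes X Y :: "real^'n::{finite,linorder}"
  assumes "\<And>i. 1 \<le> i \<Longrightarrow> i \<le> CARD('n) \<Longrightarrow> coord X i = coord Y i"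
  shows "X = Y"
  using assms[OF pos_bounds] by (simp add: coord_pos vec_eq_iff)

lemma continuous_on_vec_of:
  assumes "\<And>i. continuous_on S (\<lambda>X. f X i)"
  shows "continuous_on S (\<lambda>X. vec_of (f X))"
  unfolding vec_of_def by (intro continuous_on_vec_lambda assms)

lemma bilinear_pform: "bilinear (pform p q)"
  unfolding bilinear_def linear_iff
  by (simp add: pform_def coord_add coord_scaleR sum.distrib sum_distrib_left algebra_simps)

text \<open>
  The metric of the half-space model is this flat form divided by \<open>z\<^sup>2\<close>.
\<close>

definition flat_form :: "nat \<Rightarrow> nat \<Rightarrow> real^'m::{finite,linorder} \<Rightarrow> real^'m::_ \<Rightarrow> real" where
  "flat_form p q v w = hform p q v w + coord v (p + q) * coord w (p + q)"

lemma bilinear_flat_form: "bilinear (flat_form p q)"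
  unfolding bilinear_def linear_iff
  by (simp add: flat_form_def hform_def coord_add coord_scaleR sum.distrib sum_distrib_left
      algebra_simps)

lemma flat_form_commute: "flat_form p q v w = flat_form p q w v"
  by (simp add: flat_form_def hform_def mult.commute)

lemma bounded_bilinear_flat_form: "bounded_bilinear (flat_form p q)"
  using bilinear_flat_form bilinear_conv_bounded_bilinear by blast

text \<open>
  The first \<open>p + q - 1\<close> coordinates of \<open>v\<close>, with \<open>s\<close> inserted at place \<open>p\<close> and \<open>t\<close> put at the
  end. Linearity in \<open>(v, s, t)\<close> reduces the calculations with the lift to its three ingredients.
\<close>

definition block_vec ::
  "nat \<Rightarrow> nat \<Rightarrow> real^'m::{finite,linorder} \<Rightarrow> real \<Rightarrow> real \<Rightarrow> real^'n::{finite,linorder}" where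
  "block_vec p q v s t = vec_of (\<lambda>i.
     if i < p then coord v i else if i = p then s else if i \<le> p + q then coord v (i - 1) else t)"

lemma block_vec_add:
  "block_vec p q v s t + block_vec p q w s' t' = block_vec p q (v + w) (s + s') (t + t')"
  by (auto simp: block_vec_def vec_of_def vec_eq_iff coord_add)

lemma block_vec_scaleR: "c *\<^sub>R block_vec p q v s t = block_vec p q (c *\<^sub>R v) (c * s) (c * t)"
  by (auto simp: block_vec_def vec_of_def vec_eq_iff coord_scaleR)

lemma bounded_linear_block_vec: "bounded_linear (\<lambda>v. block_vec p q v 0 0)"
  by (simp add: linear_conv_bounded_linear[symmetric] linear_iff block_vec_add block_vec_scaleR)

lemma coord_block_vec:
  assumes "CARD('n::{finite,linorder}) = p + q + 1" "1 \<le> i" "i \<le> p + q + 1"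
  shows "coord (block_vec p q v s t :: real^'n::_) i =
     (if i < p then coord v i else if i = p then s else if i \<le> p + q then coord v (i - 1) else t)"
  using assms by (simp add: block_vec_def coord_vec_of)

lemma pform_block_vec:
  fixes v w :: "real^'m::{finite,linorder}"
  assumes "p \<ge> 1" "CARD('n::{finite,linorder}) = p + q + 1"
  shows "pform p q (block_vec p q v s t :: real^'n::_) (block_vec p q w s' t')
    = hform p q v w + s * s' - t * t'"
proof -
  let ?X = "block_vec p q v s t :: real^'n::_" and ?Y = "block_vec p q w s' t' :: real^'n::_"
  note c = coord_block_vec[OF assms(2)]
  have "{1..p} = insert p {1..<p}" using assms(1) by auto
  then have "(\<Sum>i=1..p. coord ?X i * coord ?Y i)
      = s * s' + (\<Sum>i=1..<p. coord ?X i * coord ?Y i)"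
    using assms(1) by (simp add: c)
  also have "(\<Sum>i=1..<p. coord ?X i * coord ?Y i) = (\<Sum>i=1..<p. coord v i * coord w i)"
    by (intro sum.cong) (auto simp: c)
  finally have 1: "(\<Sum>i=1..p. coord ?X i * coord ?Y i)
      = s * s' + (\<Sum>i=1..<p. coord v i * coord w i)" .
  have "{p+1..p+q+1} = insert (p+q+1) {Suc p..<Suc (p+q)}" by auto
  then have "(\<Sum>i=p+1..p+q+1. coord ?X i * coord ?Y i)
      = t * t' + (\<Sum>i=Suc p..<Suc (p+q). coord ?X i * coord ?Y i)"
    by (simp add: c)
  also have "(\<Sum>i=Suc p..<Suc (p+q). coord ?X i * coord ?Y i)
      = (\<Sum>i=p..<p+q. coord v i * coord w i)"
    unfolding sum.shift_bounds_Suc_ivl by (intro sum.cong) (auto simp: c)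
  finally show ?thesis using 1 by (simp add: pform_def hform_def)
qed


section \<open>The lift to homogeneous coordinates\<close>

definition lift :: "nat \<Rightarrow> nat \<Rightarrow> real^'m::{finite,linorder} \<Rightarrow> real^'n::{finite,linorder}" where
  "lift p q u = block_vec p q u ((1 - flat_form p q u u) / 2) ((1 + flat_form p q u u) / 2)"

definition lift_deriv ::
  "nat \<Rightarrow> nat \<Rightarrow> real^'m::{finite,linorder} \<Rightarrow> real^'m::_ \<Rightarrow> real^'n::{finite,linorder}" where
  "lift_deriv p q u v = block_vec p q v (- flat_form p q u v) (flat_form p q u v)"

text \<open>
  This is the pairing with the null vector that has the entries \<open>1\<close> and \<open>-1\<close> at the places \<open>p\<close> and
  \<open>p + q + 1\<close>. Its kernel is the hyperplane at infinity of the affine chart that contains the image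
  of the lift.
\<close>

definition height :: "nat \<Rightarrow> nat \<Rightarrow> real^'n::{finite,linorder} \<Rightarrow> real" where
  "height p q X = coord X p + coord X (p + q + 1)"

text \<open>
  A linear part, a constant null vector, and the quadratic form times a second null vector: in this
  form the lift is visibly smooth and its derivative can be read off.
\<close>

lemma lift_decomp:
  "lift p q = (\<lambda>u :: real^'m::{finite,linorder}.
     block_vec p q u 0 0 + block_vec p q (0 :: real^'m::_) (1/2) (1/2)
     + flat_form p q u u *\<^sub>R block_vec p q (0 :: real^'m::_) (-1/2) (1/2))"
  by (simp add: fun_eq_iff lift_def block_vec_add block_vec_scaleR field_simps)

lemma has_derivative_lift: "(lift p q has_derivative lift_deriv p q u) (at u)"
proof -
  have "((\<lambda>u. flat_form p q u u) has_derivative (\<lambda>v. flat_form p q u v + flat_form p q v u)) (at u)"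
    by (rule bounded_bilinear.FDERIV[OF bounded_bilinear_flat_form]) (rule has_derivative_ident)+
  then have k: "((\<lambda>u. flat_form p q u u) has_derivative (\<lambda>v. 2 * flat_form p q u v)) (at u)"
    by (simp add: flat_form_commute[of p q _ u])
  show ?thesis
    unfolding lift_decomp
    by (rule derivative_eq_intros bounded_linear_imp_has_derivative[OF bounded_linear_block_vec]
        k refl)+
       (simp add: fun_eq_iff lift_deriv_def block_vec_add block_vec_scaleR)
qed

lemma Ck_on_lift: "open S \<Longrightarrow> Ck_on k (lift p q) S"
  unfolding lift_decomp
  by (intro Ck_on_add Ck_on_bilinear[OF bounded_bilinear_scaleR]
      Ck_on_bilinear[OF bounded_bilinear_flat_form] Ck_on_const Ck_on_linear
      bounded_linear_block_vec bounded_linear_ident)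

lemma height_scaleR: "height p q (c *\<^sub>R X) = c * height p q X"
  by (simp add: height_def coord_scaleR algebra_simps)

lemma height_lift:
  assumes "p \<ge> 1" "CARD('n::{finite,linorder}) = p + q + 1"
  shows "height p q (lift p q u :: real^'n::_) = 1"
  using assms by (simp add: height_def lift_def coord_block_vec field_simps)

lemma lift_nonzero:
  assumes "p \<ge> 1" "CARD('n::{finite,linorder}) = p + q + 1"
  shows "(lift p q u :: real^'n::_) \<noteq> 0"
  using height_lift[OF assms, of u] height_scaleR[of p q 0 "lift p q u :: real^'n::_"] by auto

lemma pform_lift:
  fixes u v w :: "real^'m::{finite,linorder}"
  assumes "p \<ge> 1" "CARD('n::{finite,linorder}) = p + q + 1"
  shows "pform p q (lift p q u :: real^'n::_) (lift p q u) = - (coord u (p + q))\<^sup>2"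
    and "pform p q (lift p q u :: real^'n::_) (lift_deriv p q u v)
      = - (coord u (p + q) * coord v (p + q))"
    and "pform p q (lift_deriv p q u v :: real^'n::_) (lift p q u)
      = - (coord u (p + q) * coord v (p + q))"
    and "pform p q (lift_deriv p q u v :: real^'n::_) (lift_deriv p q u w) = hform p q v w"
proof -
  have "hform p q v u = hform p q u v"
    by (simp add: hform_def mult.commute)
  then show "pform p q (lift p q u :: real^'n::_) (lift p q u) = - (coord u (p + q))\<^sup>2"
    "pform p q (lift p q u :: real^'n::_) (lift_deriv p q u v) = - (coord u (p + q) * coord v (p + q))"
    "pform p q (lift_deriv p q u v :: real^'n::_) (lift p q u) = - (coord u (p + q) * coord v (p + q))"
    "pform p q (lift_deriv p q u v :: real^'n::_) (lift_deriv p q u w) = hform p q v w"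
    by (simp_all add: lift_def lift_deriv_def pform_block_vec[OF assms] flat_form_def
        power2_eq_square field_simps)
qed

text \<open>
  The inverse of the projectivized lift. Place \<open>p\<close> is skipped by the shift \<open>i + 1\<close>.
  The absolute value makes the last coordinate homogeneous of degree \<open>0\<close> under negative scalars too.
  Since \<open>sqrt\<close> is continuous on the whole real line, the map is continuous on all of the affine
  chart and not only where \<open>pform p q X X \<le> 0\<close>.
\<close>

definition chart :: "nat \<Rightarrow> nat \<Rightarrow> real^'n::{finite,linorder} \<Rightarrow> real^'m::{finite,linorder}" where
  "chart p q X = vec_of (\<lambda>i.
     if i < p then coord X i / height p q X
     else if i < p + q then coord X (i + 1) / height p q X
     else sqrt (- pform p q X X) / \<bar>height p q X\<bar>)"

lemma chart_lift:
  fixes u :: "real^'m::{finite,linorder}"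
  assumes "p \<ge> 1" "CARD('m) = p + q" "CARD('n::{finite,linorder}) = p + q + 1"
    and "coord u (p + q) \<ge> 0"
  shows "chart p q (lift p q u :: real^'n::_) = u"
  unfolding chart_def
proof (rule vec_of_eqI)
  fix i assume "1 \<le> i" "i \<le> CARD('m)"
  then show "(if i < p then coord (lift p q u :: real^'n::_) i / height p q (lift p q u :: real^'n::_)
     else if i < p + q then coord (lift p q u :: real^'n::_) (i + 1) / height p q (lift p q u :: real^'n::_)
     else sqrt (- pform p q (lift p q u :: real^'n::_) (lift p q u)) / \<bar>height p q (lift p q u :: real^'n::_)\<bar>)
     = coord u i"
    using assms by (auto simp: height_lift pform_lift) (auto simp: lift_def coord_block_vec)
qed

lemma chart_scaleR:
  assumes "c \<noteq> 0"
  shows "chart p q (c *\<^sub>R X) = chart p q X"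
proof -
  have "sqrt (- pform p q (c *\<^sub>R X) (c *\<^sub>R X)) = \<bar>c\<bar> * sqrt (- pform p q X X)"
    using real_sqrt_mult[of "c\<^sup>2" "- pform p q X X"]
    by (simp add: bilinear_lmul[OF bilinear_pform] bilinear_rmul[OF bilinear_pform]
        power2_eq_square algebra_simps)
  then show ?thesis
    using assms by (simp add: chart_def height_scaleR coord_scaleR abs_mult cong: if_cong)
qed

lemma continuous_on_chart: "continuous_on {X. height p q X \<noteq> 0} (chart p q)"
proof -
  have co: "continuous_on S (\<lambda>X. coord X i)" for S and i
    by (rule linear_continuous_on[OF bounded_linear_coord])
  have "continuous_on S (height p q)" for S
    unfolding height_def by (intro continuous_intros co)
  moreover have "continuous_on S (\<lambda>X. pform p q X X)" for S
    unfolding pform_def by (intro continuous_intros co)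
  ultimately have "continuous_on {X. height p q X \<noteq> 0} (\<lambda>X. coord X i / height p q X)"
    and "continuous_on {X. height p q X \<noteq> 0} (\<lambda>X. sqrt (- pform p q X X) / \<bar>height p q X\<bar>)" for i
    by (auto intro!: continuous_intros co)
  then show ?thesis
    unfolding chart_def
    by (intro continuous_on_vec_of; case_tac "i < p"; case_tac "i < p + q"; simp)
qed

lemma open_height: "open {X. height p q X \<noteq> 0}"
proof -
  have "continuous_on UNIV (height p q)"
    unfolding height_def
    by (intro continuous_intros linear_continuous_on[OF bounded_linear_coord])
  then show ?thesis by (intro open_Collect_neq continuous_on_const)
qed

text \<open>
  The assumption on \<open>T\<close> excludes only directions transversal to the boundary at a boundary point. The
  lift depends on \<open>z\<close> through \<open>z\<^sup>2\<close>, so its derivative is zero in the direction of \<open>z\<close> when \<open>z = 0\<close>.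
\<close>

lemma lift_smooth_embedding:
  fixes S T :: "(real^'m::{finite,linorder}) set"
  assumes pn: "p \<ge> 1" "CARD('m) = p + q" "CARD('n::{finite,linorder}) = p + q + 1"
    and S: "\<And>u. u \<in> S \<Longrightarrow> coord u (p + q) \<ge> 0"
    and T: "\<And>u v. u \<in> S \<Longrightarrow> v \<in> T \<Longrightarrow> coord u (p + q) \<noteq> 0 \<or> coord v (p + q) = 0"
    and N: "\<And>u. u \<in> S \<Longrightarrow> proj_class (lift p q u :: real^'n::_) \<in> N"
  shows "smooth_embedding_RP S T N (\<lambda>u. proj_class (lift p q u :: real^'n::_))"
  unfolding smooth_embedding_RP_def
proof
  show "embedding_map (top_of_set S) (subtopology RP_topology N)
      (\<lambda>u. proj_class (lift p q u :: real^'n::_))"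
  proof (rule embedding_map_proj_class)
    show "continuous_on S (lift p q :: _ \<Rightarrow> real^'n::_)"
      using Ck_on_lift[of UNIV 0 p q] continuous_on_subset by auto
    show "(0 :: real^'n::_) \<notin> {X. height p q X \<noteq> 0}"
      by (simp add: height_def coord_def)
    show "chart p q (lift p q u :: real^'n::_) = u" if "u \<in> S" for u
      using chart_lift[OF pn S[OF that]] .
  qed (auto simp: N open_height height_lift[OF pn(1,3)] height_scaleR continuous_on_chart
      chart_scaleR)
  have "v = 0" if uv: "u \<in> S" "v \<in> T" and spn: "lift_deriv p q u v \<in> span {lift p q u :: real^'n::_}" for u v
  proof -
    obtain c where c: "lift_deriv p q u v = c *\<^sub>R (lift p q u :: real^'n::_)"
      using spn by (auto simp: span_singleton)
    note cb = coord_block_vec[OF pn(3)]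
    \<comment> \<open>The height separates the lift, where it is \<open>1\<close>, from the derivatives, where it is \<open>0\<close>.\<close>
    have "height p q (lift_deriv p q u v :: real^'n::_) = 0"
      using pn by (simp add: height_def lift_deriv_def cb)
    then have "c = 0" using c by (simp add: height_scaleR height_lift[OF pn(1,3)])
    then have co: "coord (lift_deriv p q u v :: real^'n::_) i = 0" for i
      using c by (simp add: coord_def)
    have v: "coord v i = 0" if "1 \<le> i" "i < p + q" for i
      using co[of "if i < p then i else i + 1"] that
      by (auto simp: lift_deriv_def cb split: if_splits)
    \<comment> \<open>The last coordinate of \<open>v\<close> enters only through \<open>flat_form p q u v\<close>.\<close>
    have "flat_form p q u v = 0"
      using co[of p] pn(1) by (simp add: lift_deriv_def cb)
    then have "coord u (p + q) * coord v (p + q) = 0"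
      using v pn(1) by (simp add: flat_form_def hform_def)
    then have "coord v (p + q) = 0" using T[OF uv] by auto
    then have "coord v i = 0" if "1 \<le> i" "i \<le> CARD('m)" for i
      using v[of i] that pn(2) by (cases "i = p + q") auto
    then show "v = 0" by (intro coord_eqI) (simp add: coord_def)
  qed
  moreover have "frechet_derivative (lift p q) (at u) = (lift_deriv p q u :: real^'m::_ \<Rightarrow> real^'n::_)"
    for u
    by (rule frechet_derivative_at[OF has_derivative_lift, symmetric])
  ultimately show "smooth_immersion_RP S T (\<lambda>u. proj_class (lift p q u :: real^'n::_))"
    unfolding smooth_immersion_RP_def smooth_map_on_def
    using lift_nonzero[OF pn(1,3)] Ck_on_lift[of UNIV]
    by (intro ballI exI[of _ UNIV] exI[of _ "lift p q"]) auto
qed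


section \<open>The isometric embedding and its extension\<close>

text \<open>
  For \<open>z > 0\<close> this is the representative on the hyperboloid where the form takes the value \<open>-1\<close>.
\<close>

definition unit_lift :: "nat \<Rightarrow> nat \<Rightarrow> real^'m::{finite,linorder} \<Rightarrow> real^'n::{finite,linorder}" where
  "unit_lift p q u = inverse (coord u (p + q)) *\<^sub>R lift p q u"

lemma pform_unit_lift:
  assumes "p \<ge> 1" "CARD('n::{finite,linorder}) = p + q + 1" "coord u (p + q) \<noteq> 0"
  shows "pform p q (unit_lift p q u :: real^'n::_) (unit_lift p q u) = -1"
  using assms(3)
  by (simp add: unit_lift_def bilinear_lmul[OF bilinear_pform] bilinear_rmul[OF bilinear_pform]
      pform_lift[OF assms(1,2)] power2_eq_square field_simps)

text \<open>
  The derivative is \<open>D v / z - (v\<^sub>z / z\<^sup>2) lift u\<close> with \<open>D = lift_deriv p q u\<close>. In the inner product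
  of two such vectors, the square of the lift contributes \<open>-v\<^sub>z w\<^sub>z / z\<^sup>2\<close>, and each of the
  two mixed terms contributes \<open>v\<^sub>z w\<^sub>z / z\<^sup>2\<close>. One copy remains, and together with
  \<open>hform p q v w / z\<^sup>2\<close> it is the metric of the half-space model.
\<close>

lemma unit_lift_isometric:
  fixes u v w :: "real^'m::{finite,linorder}"
  assumes "p \<ge> 1" "CARD('n::{finite,linorder}) = p + q + 1" "coord u (p + q) \<noteq> 0"
  shows "pform p q (frechet_derivative (unit_lift p q :: _ \<Rightarrow> real^'n::_) (at u) v)
      (frechet_derivative (unit_lift p q) (at u) w) = half_space_metric p q u v w"
proof -
  let ?z = "coord u (p + q)"
  let ?D = "\<lambda>v. inverse ?z *\<^sub>R lift_deriv p q u v
      + (- (inverse ?z * coord v (p + q) * inverse ?z)) *\<^sub>R (lift p q u :: real^'n::_)"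
  have z: "((\<lambda>u. inverse (coord u (p + q))) has_derivative
      (\<lambda>v. - (inverse ?z * coord v (p + q) * inverse ?z))) (at u)"
    using assms(3)
    by (intro Deriv.has_derivative_inverse bounded_linear_imp_has_derivative bounded_linear_coord)
  have "(unit_lift p q has_derivative ?D) (at u)"
    unfolding unit_lift_def by (rule has_derivative_scaleR[OF z has_derivative_lift])
  then have D: "frechet_derivative (unit_lift p q) (at u) = ?D"
    by (rule frechet_derivative_at[symmetric])
  note b = bilinear_ladd[OF bilinear_pform] bilinear_radd[OF bilinear_pform]
    bilinear_lmul[OF bilinear_pform] bilinear_rmul[OF bilinear_pform]
  show ?thesis
    unfolding D b pform_lift[OF assms(1,2)] half_space_metric_def
    using assms(3) by (simp add: divide_simps power2_eq_square)
qed

lemma iota_eq_unit_lift: "iota p q u = proj_class (unit_lift p q u :: real^'n::{finite,linorder})"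
proof -
  let ?z = "coord u (p + q)"
  have "vec_of (\<lambda>i.
        if i < p then coord u i / ?z
        else if i = p then (1 - hform p q u u - ?z\<^sup>2) / (2 * ?z)
        else if i \<le> p + q then coord u (i - 1) / ?z
        else (1 + hform p q u u + ?z\<^sup>2) / (2 * ?z)) = (unit_lift p q u :: real^'n::_)"
    unfolding unit_lift_def lift_def block_vec_scaleR
    by (auto simp: block_vec_def vec_of_def vec_eq_iff coord_scaleR flat_form_def power2_eq_square
        divide_simps coord_def[of 0])
  then show ?thesis by (simp add: iota_def Let_def)
qed

theorem proposition5p1:
  fixes p q :: nat
  assumes "p \<ge> 1" and "q \<ge> 0"
    and "CARD('m::{finite,linorder}) = p + q"
    and "CARD('n::{finite,linorder}) = p + q + 1"
  shows "isometric_embedding_PH p q (half_space p q) (half_space_metric p q)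
           (iota p q :: real^'m::_ \<Rightarrow> (real^'n::_) set) \<and>
         (\<exists>f :: real^'m::_ \<Rightarrow> (real^'n::_) set.
            continuous_map (top_of_set (half_space p q \<union> half_space_boundary p q))
              (subtopology RP_topology (pseudo_hyperbolic p q \<union> boundary_at_infinity p q)) f \<and>
            (\<forall>u\<in>half_space p q. f u = iota p q u) \<and>
            smooth_embedding_RP (half_space_boundary p q) (half_space_boundary p q)
              (boundary_at_infinity p q) f)"
proof -
  let ?H = "half_space p q :: (real^'m::_) set" and ?B = "half_space_boundary p q :: (real^'m::_) set"
  let ?f = "\<lambda>u :: real^'m::_. proj_class (lift p q u :: real^'n::_)"
  note pn = assms(1,3,4) and pn' = assms(1,4)
  have H: "coord u (p + q) > 0" if "u \<in> ?H" for u using that by (simp add: half_space_def)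
  have B: "coord u (p + q) = 0" if "u \<in> ?B" for u using that by (simp add: half_space_boundary_def)
  have open_H: "open ?H"
    unfolding half_space_def
    by (intro open_Collect_less continuous_on_const linear_continuous_on bounded_linear_coord)
  have f_iota: "?f u = iota p q u" if "u \<in> ?H" for u
    using H[OF that] by (simp add: iota_eq_unit_lift unit_lift_def proj_class_scaleR)
  have f_H: "?f u \<in> pseudo_hyperbolic p q" if "u \<in> ?H" for u
    using pform_unit_lift[OF pn', of u] H[OF that]
    by (auto simp: f_iota[OF that] iota_eq_unit_lift pseudo_hyperbolic_def)
  have f_B: "?f u \<in> boundary_at_infinity p q" if "u \<in> ?B" for u
    using pform_lift(1)[OF pn', of u] B[OF that] lift_nonzero[OF pn']
    by (auto simp: boundary_at_infinity_def)
  have emb_H: "smooth_embedding_RP ?H UNIV (pseudo_hyperbolic p q) ?f"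
    by (rule lift_smooth_embedding[OF pn]) (use H f_H less_imp_le in force)+
  have emb_B: "smooth_embedding_RP ?B ?B (boundary_at_infinity p q) ?f"
    by (rule lift_smooth_embedding[OF pn]) (use B f_B in auto)
  have smooth_unit: "smooth_map_on (unit_lift p q :: _ \<Rightarrow> real^'n::_) ?H"
    unfolding smooth_map_on_def unit_lift_def using H
    by (intro allI Ck_on_bilinear[OF bounded_bilinear_scaleR] Ck_on_inverse Ck_on_lift open_H
        Ck_on_linear bounded_linear_coord) force
  have "embedding_map (top_of_set ?H) (subtopology RP_topology (pseudo_hyperbolic p q))
      (iota p q :: _ \<Rightarrow> (real^'n::_) set)"
    using emb_H f_iota embedding_map_eq[of "top_of_set ?H" _ ?f "iota p q"]
    unfolding smooth_embedding_RP_def by auto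
  moreover have "smooth_immersion_RP ?H UNIV (iota p q :: _ \<Rightarrow> (real^'n::_) set)"
    using emb_H smooth_immersion_RP_cong[of ?H ?f "iota p q"] f_iota
    by (auto simp: smooth_embedding_RP_def)
  moreover have "\<exists>V F. open V \<and> u \<in> V \<and> V \<subseteq> ?H \<and> smooth_map_on F V \<and>
      (\<forall>w\<in>V. pform p q (F w) (F w) = -1 \<and> iota p q w = proj_class (F w)) \<and>
      (\<forall>v w. pform p q (frechet_derivative F (at u) v) (frechet_derivative F (at u) w :: real^'n::_)
        = half_space_metric p q u v w)" if "u \<in> ?H" for u
  proof (intro exI[of _ ?H] exI[of _ "unit_lift p q"] conjI ballI allI)
    show "pform p q (unit_lift p q w :: real^'n::_) (unit_lift p q w) = -1" if "w \<in> ?H" for w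
      using H[OF that] by (simp add: pform_unit_lift[OF pn'])
    show "pform p q (frechet_derivative (unit_lift p q :: _ \<Rightarrow> real^'n::_) (at u) v)
        (frechet_derivative (unit_lift p q) (at u) w) = half_space_metric p q u v w" for v w
      using H[OF that] by (simp add: unit_lift_isometric[OF pn'])
  qed (use that open_H smooth_unit in \<open>simp_all add: iota_eq_unit_lift\<close>)
  ultimately have "isometric_embedding_PH p q ?H (half_space_metric p q)
      (iota p q :: _ \<Rightarrow> (real^'n::_) set)"
    by (simp add: isometric_embedding_PH_def smooth_embedding_RP_def)
  moreover have "continuous_map (top_of_set (?H \<union> ?B))
      (subtopology RP_topology (pseudo_hyperbolic p q \<union> boundary_at_infinity p q)) ?f"
  proof (rule continuous_map_proj_class)
    show "continuous_on (?H \<union> ?B) (lift p q :: _ \<Rightarrow> real^'n::_)"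
      using Ck_on_lift[of UNIV 0 p q] continuous_on_subset by auto
  qed (use f_H f_B in \<open>auto simp: lift_nonzero[OF pn']\<close>)
  ultimately show ?thesis using emb_B f_iota by (intro conjI exI[of _ ?f]) auto
qed

end
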